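(* Let $G$ be a group containing a relative difference set $R$ with forbidden subgroup $U$, and let $\mathrm{Aut}(G)_R$ be the subgroup of automorphisms of $G$ that stabilizes $R$ setwise. Let $\mathcal{G} \le \mathrm{Aut}(G)_R \ltimes G$ be a subgroup satisfying: (i) $|\mathcal{G}| = |G|$; (ii) writing $1 \times X := (1 \times G) \cap \mathcal{G}$ with $X\le G$, the subgroup $X$ is normal in $G$ and $1 \times X$ is normal in $\mathcal{G}$; and (iii) the action of $\mathcal{G}$ on $[G:X]$, the set of right cosets of $X$ in $G$, given by $$(Xh)^{(\phi,g)} := X^\phi h^\phi g = X h^\phi g$$ is transitive on $[G:X]$. Then $\mathcal{G}$ contains a relative difference set $\mathcal{R}$ with the same parameters as $R$ with respect to the forbidden subgroup $$\mathcal{U} = \{(\phi,g)\in\mathcal{G} : g\in U\}.$$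
   Context: All groups are finite. A subset $R$ of a group $G$ is an $(m,u,k,\lambda)$-relative difference set (RDS), relative to a subgroup $U\le G$ of order $u$ (the forbidden subgroup), if $|R|=k$, $|G|=mu$, and the collection $\{r_1r_2^{-1} : r_1\neq r_2\in R\}$, counted with multiplicity, contains each element of $G\setminus U$ exactly $\lambda$ times and contains no element of $U$. Automorphisms act on the right, written $g\mapsto g^\phi$, and $\phi\psi$ means first $\phi$, then $\psi$. The semidirect product $\mathrm{Aut}(G)_R\ltimes G$ is the set of pairs $(\phi,g)$ with $\phi\in\mathrm{Aut}(G)_R$, $g\in G$, and multiplication $(\phi,g)(\psi,h)=(\phi\psi,\,g^\psi h)$; $1\times G$ is the subgroup of pairs $(1,g)$.
   Formalization: The parameter λ is assumed positive; for λ = 0 (where R has at most one element) the claim can fail, e.g. G = V4, U = {0,a}, R = {0}, since the set 𝒰 need not be a subgroup. *)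

theory Defs
  imports "HOL-Algebra.Coset" "HOL-Algebra.Bij"
begin

text \<open>Intended for finite \<open>G\<close>. The definition itself allows the degenerate case \<open>l = 0\<close>
  (at most one element in \<open>R\<close> if \<open>U \<noteq> G\<close>), in which \<open>U\<close> is not determined by \<open>R\<close>.\<close>

definition relative_difference_set ::
  "('a, 'b) monoid_scheme \<Rightarrow> 'a set \<Rightarrow> 'a set \<Rightarrow> nat \<Rightarrow> nat \<Rightarrow> nat \<Rightarrow> nat \<Rightarrow> bool"
  where "relative_difference_set G U R m u k l \<longleftrightarrow>
    subgroup U G \<and> card U = u \<and> R \<subseteq> carrier G \<and> card R = k \<and> order G = m * u \<and>
    (\<forall>g \<in> carrier G - U.
       card {(r, s). r \<in> R \<and> s \<in> R \<and> r \<noteq> s \<and> r \<otimes>\<^bsub>G\<^esub> inv\<^bsub>G\<^esub> s = g} = l) \<and>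
    (\<forall>r \<in> R. \<forall>s \<in> R. r \<noteq> s \<longrightarrow> r \<otimes>\<^bsub>G\<^esub> inv\<^bsub>G\<^esub> s \<notin> U)"

text \<open>Elements of \<^const>\<open>auto\<close> are extensional on the carrier, so that automorphisms
  as functions correspond one-to-one to automorphisms as maps on the carrier.\<close>

definition aut_stabilizer :: "('a, 'b) monoid_scheme \<Rightarrow> 'a set \<Rightarrow> ('a \<Rightarrow> 'a) set"
  where "aut_stabilizer G R = {\<phi> \<in> auto G. \<phi> ` R = R}"

text \<open>Automorphisms act on the right: the product of \<open>\<phi>\<close> and \<open>\<psi>\<close> is first \<open>\<phi>\<close>, then \<open>\<psi>\<close>,
  i.e. the composition of \<open>\<psi>\<close> after \<open>\<phi>\<close>. (The product of \<^const>\<open>AutoGroup\<close> is the opposite one.)\<close>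

definition aut_semidirect ::
  "('a, 'b) monoid_scheme \<Rightarrow> 'a set \<Rightarrow> (('a \<Rightarrow> 'a) \<times> 'a) monoid"
  where "aut_semidirect G R =
    \<lparr>carrier = aut_stabilizer G R \<times> carrier G,
     mult = (\<lambda>(\<phi>, g) (\<psi>, h). (compose (carrier G) \<psi> \<phi>, \<psi> g \<otimes>\<^bsub>G\<^esub> h)),
     one = ((\<lambda>x \<in> carrier G. x), \<one>\<^bsub>G\<^esub>)\<rparr>"

text \<open>The image of a coset \<open>X h\<close> under \<open>(\<phi>, g)\<close>, taken elementwise: \<open>X\<^sup>\<phi> h\<^sup>\<phi> g\<close>.\<close>

definition coset_act :: "('a, 'b) monoid_scheme \<Rightarrow> 'a set \<Rightarrow> ('a \<Rightarrow> 'a) \<times> 'a \<Rightarrow> 'a set"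
  where "coset_act G A = (\<lambda>(\<phi>, g). (\<phi> ` A) #>\<^bsub>G\<^esub> g)"

lemma coset_act_r_coset:
  assumes "group G" "X \<subseteq> carrier G" "h \<in> carrier G" "(\<phi>, g) \<in> carrier (aut_semidirect G R)"
  shows "coset_act G (X #>\<^bsub>G\<^esub> h) (\<phi>, g) = \<phi> ` X #>\<^bsub>G\<^esub> (\<phi> h \<otimes>\<^bsub>G\<^esub> g)"
proof -
  interpret group G by fact
  have p: "\<phi> \<in> hom G G" and g: "g \<in> carrier G"
    using assms(4) by (auto simp: aut_semidirect_def aut_stabilizer_def auto_def)
  have "\<phi> (x \<otimes>\<^bsub>G\<^esub> h) \<otimes>\<^bsub>G\<^esub> g = \<phi> x \<otimes>\<^bsub>G\<^esub> (\<phi> h \<otimes>\<^bsub>G\<^esub> g)" if "x \<in> X" for x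
    using that assms(2,3) p g by (simp add: hom_mult hom_in_carrier m_assoc subsetD)
  then show ?thesis
    by (auto simp: coset_act_def r_coset_def)
qed

lemma group_aut_semidirect:
  assumes "group G" "R \<subseteq> carrier G"
  shows "group (aut_semidirect G R)"
proof -
  interpret group G by fact
  let ?S = "aut_semidirect G R" and ?A = "aut_stabilizer G R"
  have A_hom: "\<phi> \<in> hom G G" "\<phi> \<in> extensional (carrier G)" "bij_betw \<phi> (carrier G) (carrier G)"
    "\<phi> ` R = R" if "\<phi> \<in> ?A" for \<phi>
    using that by (auto simp: aut_stabilizer_def auto_def Bij_def)
  have A_in: "\<phi> x \<in> carrier G" if "\<phi> \<in> ?A" "x \<in> carrier G" for \<phi> x
    using A_hom(1)[OF that(1)] that(2) by (rule hom_in_carrier)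
  have A_mult: "\<phi> (x \<otimes>\<^bsub>G\<^esub> y) = \<phi> x \<otimes>\<^bsub>G\<^esub> \<phi> y"
    if "\<phi> \<in> ?A" "x \<in> carrier G" "y \<in> carrier G" for \<phi> x y
    using A_hom(1)[OF that(1)] that(2,3) by (rule hom_mult)
  have A_one: "\<phi> \<one>\<^bsub>G\<^esub> = \<one>\<^bsub>G\<^esub>" if "\<phi> \<in> ?A" for \<phi>
    using A_hom(1)[OF that] assms(1) by (rule hom_one[OF _ assms(1)])
  have A_id: "compose (carrier G) \<phi> (\<lambda>x \<in> carrier G. x) = \<phi>" if "\<phi> \<in> ?A" for \<phi>
    by (rule compose_Id[where B = "carrier G"]) (use that A_in A_hom(2) in auto)
  have comp: "compose (carrier G) \<psi> \<phi> \<in> ?A" if "\<phi> \<in> ?A" "\<psi> \<in> ?A" for \<phi> \<psi>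
  proof -
    have "compose (carrier G) \<psi> \<phi> \<in> auto G"
      using that compose_Bij[of \<psi> "carrier G" \<phi>]
      by (auto simp: aut_stabilizer_def auto_def intro: group.hom_compose[OF assms(1)])
    moreover have "compose (carrier G) \<psi> \<phi> ` R = \<psi> ` \<phi> ` R"
      using assms(2) by (force simp: compose_def)
    ultimately show ?thesis
      using A_hom(4)[OF that(1)] A_hom(4)[OF that(2)] by (simp add: aut_stabilizer_def)
  qed
  have id: "(\<lambda>x \<in> carrier G. x) \<in> ?A"
    using assms(2) id_in_auto by (force simp: aut_stabilizer_def)
  show ?thesis
  proof (rule groupI)
    fix a b assume "a \<in> carrier ?S" "b \<in> carrier ?S"
    then show "a \<otimes>\<^bsub>?S\<^esub> b \<in> carrier ?S"
      by (auto simp: aut_semidirect_def comp A_in)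
  next
    show "\<one>\<^bsub>?S\<^esub> \<in> carrier ?S"
      by (simp add: aut_semidirect_def id)
  next
    fix a b c assume "a \<in> carrier ?S" "b \<in> carrier ?S" "c \<in> carrier ?S"
    then show "a \<otimes>\<^bsub>?S\<^esub> b \<otimes>\<^bsub>?S\<^esub> c = a \<otimes>\<^bsub>?S\<^esub> (b \<otimes>\<^bsub>?S\<^esub> c)"
      by (auto simp: aut_semidirect_def compose_def restrict_def fun_eq_iff A_in A_mult m_assoc)
  next
    fix a assume "a \<in> carrier ?S"
    then show "\<one>\<^bsub>?S\<^esub> \<otimes>\<^bsub>?S\<^esub> a = a"
      by (auto simp: aut_semidirect_def A_one A_id)
  next
    fix a assume "a \<in> carrier ?S"
    then obtain \<phi> g where a: "a = (\<phi>, g)" "\<phi> \<in> ?A" "g \<in> carrier G"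
      by (auto simp: aut_semidirect_def)
    let ?\<psi> = "restrict (inv_into (carrier G) \<phi>) (carrier G)"
    have bij: "bij_betw \<phi> (carrier G) (carrier G)" using A_hom(3)[OF a(2)] .
    have inv: "inv_into (carrier G) \<phi> (\<phi> x) = x" "\<phi> (inv_into (carrier G) \<phi> x) = x"
      if "x \<in> carrier G" for x
      using that bij by (simp_all add: bij_betw_def inv_into_f_f f_inv_into_f)
    have "?\<psi> \<in> auto G"
      using a(2) restrict_inv_into_hom[of \<phi>]
      by (simp add: aut_stabilizer_def auto_def restrict_inv_into_Bij)
    moreover have "?\<psi> ` R = R"
    proof -
      have "?\<psi> (\<phi> x) = x" if "x \<in> R" for x
        using that assms(2) inv(1) A_in[OF a(2)] by (simp add: subsetD)
      then have "(\<lambda>x. ?\<psi> (\<phi> x)) ` R = (\<lambda>x. x) ` R"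
        by (rule image_cong[OF refl])
      then have "?\<psi> ` \<phi> ` R = R"
        unfolding image_image image_ident .
      then show ?thesis unfolding A_hom(4)[OF a(2)] .
    qed
    ultimately have psi: "?\<psi> \<in> ?A" by (simp add: aut_stabilizer_def)
    let ?b = "(?\<psi>, inv\<^bsub>G\<^esub> (?\<psi> g))"
    show "\<exists>b \<in> carrier ?S. b \<otimes>\<^bsub>?S\<^esub> a = \<one>\<^bsub>?S\<^esub>"
    proof
      have pg: "?\<psi> g \<in> carrier G" using psi a(3) by (rule A_in)
      then show "?b \<in> carrier ?S" using psi by (simp add: aut_semidirect_def del: restrict_apply)
      have hom: "group_hom G G \<phi>"
        using assms(1) A_hom(1)[OF a(2)] by (simp add: group_hom_def group_hom_axioms_def)
      have "\<phi> (inv\<^bsub>G\<^esub> (?\<psi> g)) = inv\<^bsub>G\<^esub> g"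
        using group_hom.hom_inv[OF hom pg] inv(2)[OF a(3)] a(3) by simp
      moreover have "compose (carrier G) \<phi> ?\<psi> = (\<lambda>x \<in> carrier G. x)"
        unfolding compose_def by (rule restrict_ext) (simp add: inv(2))
      ultimately show "?b \<otimes>\<^bsub>?S\<^esub> a = \<one>\<^bsub>?S\<^esub>"
        using a by (simp add: aut_semidirect_def)
    qed
  qed
qed

end

theory Submission
  imports Defs
begin

text \<open>
  Let \<open>S\<close> be the semidirect product, acting on \<open>G\<close> by \<open>h \<mapsto> \<phi> h \<otimes> g\<close>. The translations of \<open>\<G>\<close> are
  the maps \<open>h \<mapsto> h \<otimes> x\<close> with \<open>x \<in> X\<close>. They are transitive on each coset of \<open>X\<close>, because left and
  right cosets agree, and \<open>\<G>\<close> permutes these cosets transitively. So \<open>\<G>\<close> is transitive on \<open>G\<close>, and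
  as \<open>\<G>\<close> and \<open>G\<close> have the same size, it is regular: \<open>\<gamma> \<mapsto> snd \<gamma>\<close>, the orbit map of \<open>\<one>\<close>, is a
  bijection from \<open>\<G>\<close> to \<open>G\<close> (lemma \<open>bij_betw_snd\<close>). The relative difference set in \<open>\<G>\<close> is the
  preimage of \<open>R\<close> under this bijection.

  The defining property of a relative difference set is that, for \<open>g \<noteq> \<one>\<close>, the number of \<open>s \<in> R\<close>
  with \<open>g \<otimes> s \<in> R\<close> is \<open>l\<close> or \<open>0\<close> according to whether \<open>g\<close> lies outside \<open>U\<close> or in \<open>U\<close> (lemma
  \<open>relative_difference_set_iff\<close>). Geometrically, this counts the translates of \<open>R\<close> that contain both
  \<open>\<one>\<close> and \<open>g\<close>. As the automorphisms in \<open>\<G>\<close> fix \<open>R\<close>, the group \<open>\<G>\<close> permutes these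
  translates, so the count can be carried out in \<open>\<G>\<close>: with \<open>\<kappa> \<gamma> = inv (snd (inv \<gamma>))\<close>, which is also a
  bijection from \<open>\<G>\<close> to \<open>G\<close>, one has \<open>snd \<gamma> = \<phi> (\<kappa> \<gamma>)\<close> and \<open>snd (\<delta> \<otimes> \<gamma>) = \<phi> (snd \<delta> \<otimes> \<kappa> \<gamma>)\<close> for
  \<open>\<gamma> = (\<phi>, _)\<close>. Hence \<open>\<gamma>\<close> and \<open>\<delta> \<otimes> \<gamma>\<close> both lie over \<open>R\<close> iff \<open>\<kappa> \<gamma>\<close> and \<open>snd \<delta> \<otimes> \<kappa> \<gamma>\<close> both lie
  in \<open>R\<close>.

  Finally, \<open>\<U>\<close> is a subgroup because automorphisms fixing \<open>R\<close> also fix \<open>U\<close>: for \<open>l > 0\<close>, the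
  complement of \<open>U\<close> is the set of differences of \<open>R\<close>.
\<close>

section \<open>Relative difference sets by counting translates\<close>

lemma (in group) card_differences_eq:
  assumes "R \<subseteq> carrier G" "g \<in> carrier G" "g \<noteq> \<one>"
  shows "card {(r, s). r \<in> R \<and> s \<in> R \<and> r \<noteq> s \<and> r \<otimes> inv s = g} = card {s \<in> R. g \<otimes> s \<in> R}"
proof -
  have eq: "r \<otimes> inv s = g \<longleftrightarrow> r = g \<otimes> s" if "r \<in> R" "s \<in> R" for r s
    using that assms(1,2) by (intro inv_solve_right') auto
  have ne: "g \<otimes> s \<noteq> s" if "s \<in> R" for s
    using that assms r_cancel_one[of s g] by auto
  have "{(r, s). r \<in> R \<and> s \<in> R \<and> r \<noteq> s \<and> r \<otimes> inv s = g} = {(r, s). r \<in> R \<and> s \<in> R \<and> r = g \<otimes> s}"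
    using eq ne by (intro Collect_cong) auto
  also have "\<dots> = (\<lambda>s. (g \<otimes> s, s)) ` {s \<in> R. g \<otimes> s \<in> R}"
    by auto
  finally show ?thesis
    by (simp add: card_image inj_on_def)
qed

text \<open>Counting the \<open>s\<close> with \<open>s, g \<otimes> s \<in> R\<close> merges the two conditions on differences into one,
  in which \<open>R\<close> enters only through membership; this is the form that is carried over to \<open>\<G>\<close>.\<close>

lemma (in group) relative_difference_set_iff:
  assumes "finite (carrier G)"
  shows "relative_difference_set G U R m u k l \<longleftrightarrow>
    subgroup U G \<and> card U = u \<and> R \<subseteq> carrier G \<and> card R = k \<and> order G = m * u \<and>
    (\<forall>g \<in> carrier G. g \<noteq> \<one> \<longrightarrow> card {s \<in> R. g \<otimes> s \<in> R} = (if g \<in> U then 0 else l))"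
    (is "_ \<longleftrightarrow> _ \<and> _ \<and> _ \<and> _ \<and> _ \<and> ?count")
proof -
  have "((\<forall>g \<in> carrier G - U. card {(r, s). r \<in> R \<and> s \<in> R \<and> r \<noteq> s \<and> r \<otimes> inv s = g} = l) \<and>
    (\<forall>r \<in> R. \<forall>s \<in> R. r \<noteq> s \<longrightarrow> r \<otimes> inv s \<notin> U)) \<longleftrightarrow> ?count"
    if U: "subgroup U G" and R: "R \<subseteq> carrier G"
  proof -
    let ?D = "\<lambda>g. {(r, s). r \<in> R \<and> s \<in> R \<and> r \<noteq> s \<and> r \<otimes> inv s = g}"
    have fin: "finite (?D g)" for g
      using finite_subset[OF R assms] by (auto intro: finite_subset[of _ "R \<times> R"])
    have one: "\<one> \<in> U" using U by (rule subgroup.one_closed)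
    have diff: "r \<otimes> inv s \<in> carrier G - {\<one>}" if "r \<in> R" "s \<in> R" "r \<noteq> s" for r s
    proof -
      have c: "r \<in> carrier G" "s \<in> carrier G" using that R by auto
      then have "r \<otimes> inv s = \<one> \<longleftrightarrow> r = s" using inv_solve_right'[of "\<one>" r s] by simp
      then show ?thesis using c that(3) by simp
    qed
    have "(\<forall>r \<in> R. \<forall>s \<in> R. r \<noteq> s \<longrightarrow> r \<otimes> inv s \<notin> U) \<longleftrightarrow>
        (\<forall>g \<in> carrier G \<inter> U. g \<noteq> \<one> \<longrightarrow> ?D g = {})"
      using diff by blast
    also have "\<dots> \<longleftrightarrow> (\<forall>g \<in> carrier G \<inter> U. g \<noteq> \<one> \<longrightarrow> card {s \<in> R. g \<otimes> s \<in> R} = 0)"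
      by (intro ball_cong refl imp_cong)
        (simp add: card_differences_eq[OF R, symmetric] card_0_eq[OF fin])
    finally have inside: "(\<forall>r \<in> R. \<forall>s \<in> R. r \<noteq> s \<longrightarrow> r \<otimes> inv s \<notin> U) \<longleftrightarrow>
        (\<forall>g \<in> carrier G \<inter> U. g \<noteq> \<one> \<longrightarrow> card {s \<in> R. g \<otimes> s \<in> R} = 0)" .
    have outside: "(\<forall>g \<in> carrier G - U. card (?D g) = l) \<longleftrightarrow>
        (\<forall>g \<in> carrier G - U. g \<noteq> \<one> \<longrightarrow> card {s \<in> R. g \<otimes> s \<in> R} = l)"
    proof (rule ball_cong[OF refl])
      fix g assume "g \<in> carrier G - U"
      then have "g \<in> carrier G" "g \<noteq> \<one>" using one by auto
      then show "(card (?D g) = l) \<longleftrightarrow> (g \<noteq> \<one> \<longrightarrow> card {s \<in> R. g \<otimes> s \<in> R} = l)"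
        using card_differences_eq[OF R] by simp
    qed
    show ?thesis unfolding inside outside by auto
  qed
  then show ?thesis unfolding relative_difference_set_def by blast
qed

section \<open>Automorphisms that stabilize a relative difference set\<close>

lemma aut_stabilizerD:
  assumes "group G" "\<phi> \<in> aut_stabilizer G R"
  shows "group_hom G G \<phi>" "inj_on \<phi> (carrier G)" "\<phi> ` R = R"
  using assms
  by (auto simp: aut_stabilizer_def auto_def Bij_def bij_betw_def group_hom_def group_hom_axioms_def)

lemma aut_stabilizer_mem_iff:
  assumes "group G" "\<phi> \<in> aut_stabilizer G R" "R \<subseteq> carrier G" "x \<in> carrier G"
  shows "\<phi> x \<in> R \<longleftrightarrow> x \<in> R"
  using aut_stabilizerD[OF assms(1,2)] inj_on_image_mem_iff[of \<phi> "carrier G" x R] assms(3,4) by auto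

lemma (in group) outside_forbidden_iff_difference:
  assumes "relative_difference_set G U R m u k l" "l > 0" "x \<in> carrier G"
  shows "x \<notin> U \<longleftrightarrow> (\<exists>r \<in> R. \<exists>s \<in> R. r \<noteq> s \<and> x = r \<otimes> inv s)"
proof
  assume "x \<notin> U"
  then have "card {(r, s). r \<in> R \<and> s \<in> R \<and> r \<noteq> s \<and> r \<otimes> inv s = x} \<noteq> 0"
    using assms by (simp add: relative_difference_set_def)
  then have "{(r, s). r \<in> R \<and> s \<in> R \<and> r \<noteq> s \<and> r \<otimes> inv s = x} \<noteq> {}"
    by (metis card.empty)
  then show "\<exists>r \<in> R. \<exists>s \<in> R. r \<noteq> s \<and> x = r \<otimes> inv s" by auto
next
  assume "\<exists>r \<in> R. \<exists>s \<in> R. r \<noteq> s \<and> x = r \<otimes> inv s"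
  then show "x \<notin> U" using assms(1) unfolding relative_difference_set_def by blast
qed

text \<open>An automorphism that permutes \<open>R\<close> permutes the differences of \<open>R\<close>, which for \<open>l > 0\<close> make up
  the complement of \<open>U\<close>. With \<open>l = 0\<close> the set \<open>R\<close> would not determine \<open>U\<close>.\<close>

lemma (in group) aut_stabilizer_forbidden_iff:
  assumes rds: "relative_difference_set G U R m u k l" and l: "l > 0"
    and \<phi>: "\<phi> \<in> aut_stabilizer G R" and x: "x \<in> carrier G"
  shows "\<phi> x \<in> U \<longleftrightarrow> x \<in> U"
proof -
  interpret \<phi>: group_hom G G \<phi> using aut_stabilizerD(1)[OF is_group \<phi>] .
  note inj = aut_stabilizerD(2)[OF is_group \<phi>] and im = aut_stabilizerD(3)[OF is_group \<phi>]
  have R: "R \<subseteq> carrier G" using rds by (simp add: relative_difference_set_def)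
  have step: "(\<phi> r \<noteq> \<phi> s \<and> \<phi> x = \<phi> r \<otimes> inv (\<phi> s)) \<longleftrightarrow> (r \<noteq> s \<and> x = r \<otimes> inv s)"
    if "r \<in> R" "s \<in> R" for r s
  proof -
    have c: "r \<in> carrier G" "s \<in> carrier G" using that R by auto
    then have "\<phi> r \<otimes> inv (\<phi> s) = \<phi> (r \<otimes> inv s)" by simp
    moreover have "\<phi> r = \<phi> s \<longleftrightarrow> r = s" "\<phi> x = \<phi> (r \<otimes> inv s) \<longleftrightarrow> x = r \<otimes> inv s"
      using c x by (simp_all add: inj_on_eq_iff[OF inj] del: \<phi>.hom_mult \<phi>.hom_inv)
    ultimately show ?thesis by simp
  qed
  have "\<phi> x \<notin> U \<longleftrightarrow> (\<exists>r \<in> \<phi> ` R. \<exists>s \<in> \<phi> ` R. r \<noteq> s \<and> \<phi> x = r \<otimes> inv s)"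
    using outside_forbidden_iff_difference[OF rds l \<phi>.hom_closed[OF x]] im by simp
  also have "\<dots> \<longleftrightarrow> (\<exists>r \<in> R. \<exists>s \<in> R. r \<noteq> s \<and> x = r \<otimes> inv s)"
    using step by blast
  also have "\<dots> \<longleftrightarrow> x \<notin> U"
    using outside_forbidden_iff_difference[OF rds l x] by simp
  finally show ?thesis by simp
qed

section \<open>Regular subgroups of the semidirect product\<close>

text \<open>The second component of \<open>\<gamma>\<close> is the image of \<open>\<one>\<close> under \<open>\<gamma>\<close>. Some \<open>\<gamma> \<in> \<G>\<close> moves \<open>\<one>\<close> into the
  coset of \<open>g\<close>; a translation by an element of \<open>X\<close> then corrects it to \<open>g\<close> itself, where
  normality of \<open>X\<close> is needed since \<open>\<G>\<close> translates from the right but the cosets are \<open>X #> g\<close>.\<close>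

lemma (in group) bij_betw_snd:
  assumes fin: "finite (carrier G)"
    and sub: "subgroup \<G> (aut_semidirect G R)" and card: "card \<G> = order G"
    and X: "X \<lhd> G" and trans: "{\<lambda>x \<in> carrier G. x} \<times> X \<subseteq> \<G>"
    and cosets: "\<forall>A \<in> rcosets X. \<forall>B \<in> rcosets X. \<exists>\<gamma> \<in> \<G>. coset_act G A \<gamma> = B"
  shows "bij_betw snd \<G> (carrier G)"
proof -
  interpret X: normal X G by fact
  have \<G>: "\<G> \<subseteq> aut_stabilizer G R \<times> carrier G"
    using subgroup.subset[OF sub] by (simp add: aut_semidirect_def)
  have "g \<in> snd ` \<G>" if g: "g \<in> carrier G" for g
  proof -
    have "X \<in> rcosets X" "X #> g \<in> rcosets X"
      using g X.subset X.subgroup_in_rcosets[OF is_group] by (simp_all add: rcosetsI)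
    then obtain \<phi> h where \<gamma>: "(\<phi>, h) \<in> \<G>" and img: "\<phi> ` X #> h = X #> g"
      using cosets by (fastforce simp: coset_act_def)
    then have \<phi>: "\<phi> \<in> aut_stabilizer G R" and h: "h \<in> carrier G" using \<G> by auto
    have "\<phi> \<one> = \<one>"
      using group_hom.hom_one[OF aut_stabilizerD(1)[OF is_group \<phi>]] .
    then have "\<one> \<in> \<phi> ` X" using imageI[OF X.one_closed, of \<phi>] by simp
    then have "\<one> \<otimes> h \<in> \<phi> ` X #> h" unfolding r_coset_def by blast
    then have "h \<in> X #> g" using img h by simp
    then have "X #> g = X #> h"
      using g X.subgroup_axioms by (rule repr_independence)
    then have "g \<in> X #> h"
      using rcos_self[OF g X.subgroup_axioms] by simp
    then have "g \<in> h <# X" using X.coset_eq h by blast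
    then obtain y where y: "y \<in> X" "g = h \<otimes> y" by (auto simp: l_coset_def)
    have "(\<lambda>x \<in> carrier G. x, y) \<in> \<G>" using trans y(1) by auto
    from subgroup.m_closed[OF sub \<gamma> this] have "(compose (carrier G) (\<lambda>x \<in> carrier G. x) \<phi>, g) \<in> \<G>"
      using h y by (simp add: aut_semidirect_def)
    then show ?thesis by force
  qed
  then have surj: "snd ` \<G> = carrier G" using \<G> by auto
  have "finite \<G>"
    using card fin order_gt_0_iff_finite card_ge_0_finite by metis
  then have "inj_on snd \<G>"
    using surj card by (simp add: eq_card_imp_inj_on order_def)
  then show ?thesis using surj by (simp add: bij_betw_def)
qed

text \<open>Bijectivity of \<open>snd\<close> means that \<open>\<G>\<close> acts regularly on \<open>G\<close>. The number of \<open>\<gamma>\<close> for which \<open>\<gamma>\<close> and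
  \<open>\<delta> \<otimes> \<gamma>\<close> lie over \<open>R\<close> is computed in \<open>G\<close> after undoing, for each \<open>\<gamma>\<close> separately, the automorphism
  \<open>fst \<gamma>\<close>; this does not change membership in \<open>R\<close>.\<close>

lemma (in group) relative_difference_set_regular_subgroup:
  assumes fin: "finite (carrier G)" and l: "l > 0"
    and rds: "relative_difference_set G U R m u k l"
    and sub: "subgroup \<G> (aut_semidirect G R)"
    and bij: "bij_betw snd \<G> (carrier G)"
  shows "relative_difference_set (aut_semidirect G R\<lparr>carrier := \<G>\<rparr>)
    {\<gamma> \<in> \<G>. snd \<gamma> \<in> U} {\<gamma> \<in> \<G>. snd \<gamma> \<in> R} m u k l"
proof -
  let ?\<Gamma> = "aut_semidirect G R\<lparr>carrier := \<G>\<rparr>"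
  have U: "subgroup U G" and R: "R \<subseteq> carrier G"
    and params: "card U = u" "card R = k" "order G = m * u"
    and count: "\<And>g. g \<in> carrier G \<Longrightarrow> g \<noteq> \<one> \<Longrightarrow>
      card {s \<in> R. g \<otimes> s \<in> R} = (if g \<in> U then 0 else l)"
    using rds by (simp_all add: relative_difference_set_iff[OF fin])
  interpret \<Gamma>: group ?\<Gamma>
    using subgroup.subgroup_is_group[OF sub group_aut_semidirect[OF is_group R]] .
  have \<G>: "\<G> \<subseteq> aut_stabilizer G R \<times> carrier G"
    using subgroup.subset[OF sub] by (simp add: aut_semidirect_def)
  have aut: "fst \<gamma> \<in> aut_stabilizer G R" and snd_carrier: "snd \<gamma> \<in> carrier G" if "\<gamma> \<in> \<G>" for \<gamma>
    using that \<G> by auto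
  have hom: "group_hom G G (fst \<gamma>)" if "\<gamma> \<in> \<G>" for \<gamma>
    using aut_stabilizerD(1)[OF is_group aut[OF that]] .
  have snd_mult: "snd (\<delta> \<otimes>\<^bsub>?\<Gamma>\<^esub> \<gamma>) = fst \<gamma> (snd \<delta>) \<otimes> snd \<gamma>" for \<gamma> \<delta>
    by (simp add: aut_semidirect_def case_prod_beta)
  have snd_one: "snd \<one>\<^bsub>?\<Gamma>\<^esub> = \<one>"
    by (simp add: aut_semidirect_def)
  have inv_in: "inv\<^bsub>?\<Gamma>\<^esub> \<gamma> \<in> \<G>" if "\<gamma> \<in> \<G>" for \<gamma>
    using \<Gamma>.inv_closed that by simp
  have snd_inv: "fst \<gamma> (snd (inv\<^bsub>?\<Gamma>\<^esub> \<gamma>)) = inv (snd \<gamma>)" if "\<gamma> \<in> \<G>" for \<gamma>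
  proof -
    have "fst \<gamma> (snd (inv\<^bsub>?\<Gamma>\<^esub> \<gamma>)) \<otimes> snd \<gamma> = \<one>"
      using \<Gamma>.l_inv[of \<gamma>] that snd_mult[of "inv\<^bsub>?\<Gamma>\<^esub> \<gamma>" \<gamma>] snd_one by simp
    then show ?thesis
      using inv_equality[OF _ snd_carrier[OF that]]
        group_hom.hom_closed[OF hom[OF that] snd_carrier[OF inv_in[OF that]]] by simp
  qed

  have preimage_card: "card {\<gamma> \<in> \<G>. f \<gamma> \<in> A} = card A"
    if f: "bij_betw f \<G> (carrier G)" and A: "A \<subseteq> carrier G" for f and A :: "'a set"
  proof -
    have "f ` {\<gamma> \<in> \<G>. f \<gamma> \<in> A} = A"
      using A bij_betw_imp_surj_on[OF f] by auto
    moreover have "inj_on f {\<gamma> \<in> \<G>. f \<gamma> \<in> A}"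
      by (rule inj_on_subset[OF bij_betw_imp_inj_on[OF f]]) auto
    ultimately show ?thesis using card_image[of f "{\<gamma> \<in> \<G>. f \<gamma> \<in> A}"] by simp
  qed

  have sub_U: "subgroup {\<gamma> \<in> \<G>. snd \<gamma> \<in> U} ?\<Gamma>"
  proof (rule \<Gamma>.subgroupI)
    show "{\<gamma> \<in> \<G>. snd \<gamma> \<in> U} \<subseteq> carrier ?\<Gamma>" by auto
    have "\<one>\<^bsub>?\<Gamma>\<^esub> \<in> {\<gamma> \<in> \<G>. snd \<gamma> \<in> U}"
      using \<Gamma>.one_closed snd_one subgroup.one_closed[OF U] by simp
    then show "{\<gamma> \<in> \<G>. snd \<gamma> \<in> U} \<noteq> {}" by blast
  next
    fix \<gamma> assume "\<gamma> \<in> {\<gamma> \<in> \<G>. snd \<gamma> \<in> U}"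
    then have \<gamma>: "\<gamma> \<in> \<G>" "snd \<gamma> \<in> U" by auto
    have "fst \<gamma> (snd (inv\<^bsub>?\<Gamma>\<^esub> \<gamma>)) \<in> U"
      using snd_inv[OF \<gamma>(1)] subgroup.m_inv_closed[OF U \<gamma>(2)] by simp
    then show "inv\<^bsub>?\<Gamma>\<^esub> \<gamma> \<in> {\<gamma> \<in> \<G>. snd \<gamma> \<in> U}"
      using aut_stabilizer_forbidden_iff[OF rds l aut[OF \<gamma>(1)]] inv_in[OF \<gamma>(1)] snd_carrier by auto
  next
    fix \<delta> \<gamma> assume "\<delta> \<in> {\<gamma> \<in> \<G>. snd \<gamma> \<in> U}" "\<gamma> \<in> {\<gamma> \<in> \<G>. snd \<gamma> \<in> U}"
    then have \<delta>: "\<delta> \<in> \<G>" "snd \<delta> \<in> U" and \<gamma>: "\<gamma> \<in> \<G>" "snd \<gamma> \<in> U" by auto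
    have "fst \<gamma> (snd \<delta>) \<otimes> snd \<gamma> \<in> U"
      using aut_stabilizer_forbidden_iff[OF rds l aut[OF \<gamma>(1)] snd_carrier[OF \<delta>(1)]] \<delta>(2) \<gamma>(2)
      by (simp add: subgroup.m_closed[OF U])
    then show "\<delta> \<otimes>\<^bsub>?\<Gamma>\<^esub> \<gamma> \<in> {\<gamma> \<in> \<G>. snd \<gamma> \<in> U}"
      using \<Gamma>.m_closed[of \<delta> \<gamma>] \<delta>(1) \<gamma>(1) snd_mult[of \<delta> \<gamma>] by simp
  qed

  \<comment> \<open>If \<open>\<gamma> = (\<phi>, g)\<close>, then \<open>\<kappa> \<gamma>\<close> is the preimage of \<open>g\<close> under \<open>\<phi>\<close>. Written with inverses, it is
    visibly a bijection, although \<open>\<phi>\<close> varies with \<open>\<gamma>\<close>.\<close>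
  define \<kappa> where "\<kappa> \<gamma> = inv (snd (inv\<^bsub>?\<Gamma>\<^esub> \<gamma>))" for \<gamma>
  have \<kappa>_carrier: "\<kappa> \<gamma> \<in> carrier G" if "\<gamma> \<in> \<G>" for \<gamma>
    using that by (simp add: \<kappa>_def snd_carrier inv_in)
  have \<kappa>_inj: "inj_on \<kappa> \<G>"
  proof (rule inj_onI)
    fix \<gamma> \<delta> assume \<gamma>: "\<gamma> \<in> \<G>" and \<delta>: "\<delta> \<in> \<G>" and "\<kappa> \<gamma> = \<kappa> \<delta>"
    then have "inv (\<kappa> \<gamma>) = inv (\<kappa> \<delta>)" by simp
    then have "snd (inv\<^bsub>?\<Gamma>\<^esub> \<gamma>) = snd (inv\<^bsub>?\<Gamma>\<^esub> \<delta>)"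
      using \<gamma> \<delta> by (simp add: \<kappa>_def snd_carrier inv_in)
    then have "inv\<^bsub>?\<Gamma>\<^esub> \<gamma> = inv\<^bsub>?\<Gamma>\<^esub> \<delta>"
      using inj_onD[OF bij_betw_imp_inj_on[OF bij]] inv_in \<gamma> \<delta> by blast
    then show "\<gamma> = \<delta>"
      by (rule inj_onD[OF \<Gamma>.inv_inj]) (simp_all add: \<gamma> \<delta>)
  qed
  have "\<kappa> ` \<G> = carrier G"
    using \<kappa>_inj \<kappa>_carrier fin bij bij_betw_same_card[OF bij]
    by (intro card_subset_eq) (auto simp: card_image)
  with \<kappa>_inj have \<kappa>_bij: "bij_betw \<kappa> \<G> (carrier G)" by (simp add: bij_betw_def)
  have snd_\<kappa>: "fst \<gamma> (\<kappa> \<gamma>) = snd \<gamma>" if "\<gamma> \<in> \<G>" for \<gamma>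
    using that snd_inv[OF that]
    by (simp add: \<kappa>_def group_hom.hom_inv[OF hom] inv_in snd_carrier)
  have snd_mult_\<kappa>: "snd (\<delta> \<otimes>\<^bsub>?\<Gamma>\<^esub> \<gamma>) = fst \<gamma> (snd \<delta> \<otimes> \<kappa> \<gamma>)" if "\<delta> \<in> \<G>" "\<gamma> \<in> \<G>" for \<delta> \<gamma>
    unfolding snd_mult
    using that snd_\<kappa>[of \<gamma>] by (simp add: group_hom.hom_mult[OF hom] snd_carrier \<kappa>_carrier)

  have transfer: "card {\<gamma> \<in> {\<gamma> \<in> \<G>. snd \<gamma> \<in> R}. \<delta> \<otimes>\<^bsub>?\<Gamma>\<^esub> \<gamma> \<in> {\<gamma> \<in> \<G>. snd \<gamma> \<in> R}} =
      card {s \<in> R. snd \<delta> \<otimes> s \<in> R}" if \<delta>: "\<delta> \<in> \<G>" for \<delta>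
  proof -
    have 1: "snd \<gamma> \<in> R \<longleftrightarrow> \<kappa> \<gamma> \<in> R" if "\<gamma> \<in> \<G>" for \<gamma>
      using aut_stabilizer_mem_iff[OF is_group aut[OF that] R \<kappa>_carrier[OF that]] snd_\<kappa>[OF that]
      by simp
    have 2: "\<delta> \<otimes>\<^bsub>?\<Gamma>\<^esub> \<gamma> \<in> \<G> \<and> snd (\<delta> \<otimes>\<^bsub>?\<Gamma>\<^esub> \<gamma>) \<in> R \<longleftrightarrow> snd \<delta> \<otimes> \<kappa> \<gamma> \<in> R" if "\<gamma> \<in> \<G>" for \<gamma>
      using aut_stabilizer_mem_iff[OF is_group aut[OF that] R, of "snd \<delta> \<otimes> \<kappa> \<gamma>"]
        snd_mult_\<kappa>[OF \<delta> that] \<Gamma>.m_closed[of \<delta> \<gamma>] \<delta> that snd_carrier \<kappa>_carrier by simp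
    let ?C = "{\<gamma> \<in> {\<gamma> \<in> \<G>. snd \<gamma> \<in> R}. \<delta> \<otimes>\<^bsub>?\<Gamma>\<^esub> \<gamma> \<in> {\<gamma> \<in> \<G>. snd \<gamma> \<in> R}}"
    have C: "?C = {\<gamma> \<in> \<G>. \<kappa> \<gamma> \<in> {s \<in> R. snd \<delta> \<otimes> s \<in> R}}"
      using 1 2 by blast
    have "{s \<in> R. snd \<delta> \<otimes> s \<in> R} \<subseteq> carrier G" using R by auto
    with \<kappa>_bij show ?thesis unfolding C by (rule preimage_card)
  qed
  have nontrivial: "snd \<delta> \<noteq> \<one>" if "\<delta> \<in> \<G>" "\<delta> \<noteq> \<one>\<^bsub>?\<Gamma>\<^esub>" for \<delta>
    using that snd_one \<Gamma>.one_closed inj_onD[OF bij_betw_imp_inj_on[OF bij], of \<delta> "\<one>\<^bsub>?\<Gamma>\<^esub>"] by auto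

  have fin_\<Gamma>: "finite (carrier ?\<Gamma>)"
    using bij_betw_finite[OF bij] fin by simp
  show ?thesis
    unfolding \<Gamma>.relative_difference_set_iff[OF fin_\<Gamma>]
  proof (intro conjI ballI impI)
    show "card {\<gamma> \<in> \<G>. snd \<gamma> \<in> U} = u"
      using preimage_card[OF bij subgroup.subset[OF U]] params by simp
    show "card {\<gamma> \<in> \<G>. snd \<gamma> \<in> R} = k"
      using preimage_card[OF bij R] params by simp
    show "order ?\<Gamma> = m * u"
      using bij_betw_same_card[OF bij] params by (simp add: order_def)
  next
    fix \<delta> assume "\<delta> \<in> carrier ?\<Gamma>" and ne: "\<delta> \<noteq> \<one>\<^bsub>?\<Gamma>\<^esub>"
    then have \<delta>: "\<delta> \<in> \<G>" by simp
    show "card {\<gamma> \<in> {\<gamma> \<in> \<G>. snd \<gamma> \<in> R}. \<delta> \<otimes>\<^bsub>?\<Gamma>\<^esub> \<gamma> \<in> {\<gamma> \<in> \<G>. snd \<gamma> \<in> R}} =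
        (if \<delta> \<in> {\<gamma> \<in> \<G>. snd \<gamma> \<in> U} then 0 else l)"
      using transfer[OF \<delta>] count[OF snd_carrier[OF \<delta>] nontrivial[OF \<delta> ne]] \<delta> by simp
  qed (use sub_U in auto)
qed

section \<open>Subgroups transitive on the cosets of their translations\<close>

theorem theorem1p2:
  fixes G :: "('a, 'b) monoid_scheme"
    and U R X :: "'a set"
    and m u k l :: nat
    and \<G> :: "(('a \<Rightarrow> 'a) \<times> 'a) set"
  assumes "group G" and "finite (carrier G)"
    and "l > 0"
    and "relative_difference_set G U R m u k l"
    and "subgroup \<G> (aut_semidirect G R)"
    and "card \<G> = order G"
    and "X \<subseteq> carrier G"
    and "{\<lambda>x \<in> carrier G. x} \<times> X = ({\<lambda>x \<in> carrier G. x} \<times> carrier G) \<inter> \<G>"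
    and "X \<lhd> G"
    and "({\<lambda>x \<in> carrier G. x} \<times> X) \<lhd> (aut_semidirect G R\<lparr>carrier := \<G>\<rparr>)"
    and "\<forall>A \<in> rcosets\<^bsub>G\<^esub> X. \<forall>B \<in> rcosets\<^bsub>G\<^esub> X. \<exists>\<gamma> \<in> \<G>. coset_act G A \<gamma> = B"
  shows "\<exists>\<R>. relative_difference_set (aut_semidirect G R\<lparr>carrier := \<G>\<rparr>)
                {(\<phi>, g) \<in> \<G>. g \<in> U} \<R> m u k l"
proof -
  interpret group G by fact
  have "{\<lambda>x \<in> carrier G. x} \<times> X \<subseteq> \<G>"
    using assms(8) by blast
  then have "bij_betw snd \<G> (carrier G)"
    using bij_betw_snd assms(2,5,6,9,11) by blast
  then have "relative_difference_set (aut_semidirect G R\<lparr>carrier := \<G>\<rparr>)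
      {\<gamma> \<in> \<G>. snd \<gamma> \<in> U} {\<gamma> \<in> \<G>. snd \<gamma> \<in> R} m u k l"
    using relative_difference_set_regular_subgroup assms(2-5) by blast
  moreover have "{\<gamma> \<in> \<G>. snd \<gamma> \<in> U} = {(\<phi>, g) \<in> \<G>. g \<in> U}"
    by auto
  ultimately show ?thesis by auto
qed

end
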